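(* Let $A\in\mathbb{R}^{n\times n}$. If $A$ is DT diagonally stable, i.e. there exists a diagonal matrix $P\in\mathbb{R}^{n\times n}$ with positive diagonal entries such that $A^TPA\prec P$, then $A$ is DT $k$-diagonally stable for any $k\in\{1,\dots,n-1\}$.
   Context: For $k\in\{1,\dots,n\}$, the $k$th multiplicative compound $A^{(k)}$ of $A\in\mathbb{R}^{n\times n}$ is the $\binom{n}{k}\times\binom{n}{k}$ matrix whose entries are all the $k\times k$ minors of $A$, with rows and columns indexed by the $k$-element subsets (increasing sequences) of $\{1,\dots,n\}$ in lexicographic order. For symmetric matrices, $P\prec Q$ means that $Q-P$ is positive-definite. For $k\in\{1,\dots,n-1\}$ and $r:=\binom{n}{k}$, $A$ is called DT $k$-diagonally stable if there exists a diagonal matrix $D\in\mathbb{R}^{r\times r}$ with positive diagonal entries such that $(A^{(k)})^TDA^{(k)}\prec D$. *)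

theory Defs
  imports
    "Jordan_Normal_Form.Determinant"
    "Jordan_Normal_Form.DL_Submatrix"
begin

text \<open>Indices are 0-based, as in \<^theory>\<open>Jordan_Normal_Form.Matrix\<close>: the index set
  \<open>{1,...,n}\<close> becomes \<open>{0,...,n-1}\<close>. A \<open>k\<close>-element subset is represented by the
  increasing list of its elements. The function \<^const>\<open>subseqs\<close> lists the sublists
  containing the head before those that do not, so that the sublists of a fixed length come out
  in lexicographic order; this is \<open>sorted_wrt_lex_ksubsets\<close> below.\<close>

definition ksubsets :: "nat \<Rightarrow> nat \<Rightarrow> nat list list" where
  "ksubsets n k = filter (\<lambda>xs. length xs = k) (subseqs [0..<n])"

definition compound_mat :: "nat \<Rightarrow> real mat \<Rightarrow> real mat" where
  "compound_mat k A =
     (let R = ksubsets (dim_row A) k; C = ksubsets (dim_col A) k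
      in mat (length R) (length C)
           (\<lambda>(i, j). det (submatrix A (set (R ! i)) (set (C ! j)))))"

definition symmetric_mat :: "real mat \<Rightarrow> bool" where
  "symmetric_mat M \<longleftrightarrow> transpose_mat M = M"

definition pos_def_mat :: "real mat \<Rightarrow> bool" where
  "pos_def_mat M \<longleftrightarrow> symmetric_mat M \<and>
     (\<forall>v \<in> carrier_vec (dim_row M). v \<noteq> 0\<^sub>v (dim_row M) \<longrightarrow> 0 < v \<bullet> (M *\<^sub>v v))"

definition loewner_less :: "real mat \<Rightarrow> real mat \<Rightarrow> bool"  (infix \<open>\<prec>\<close> 50) where
  "P \<prec> Q \<longleftrightarrow> dim_row P = dim_row Q \<and> dim_col P = dim_col Q \<and>
     symmetric_mat P \<and> symmetric_mat Q \<and> pos_def_mat (Q - P)"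

definition pos_diagonal_mat :: "nat \<Rightarrow> real mat \<Rightarrow> bool" where
  "pos_diagonal_mat n D \<longleftrightarrow>
     D \<in> carrier_mat n n \<and> diagonal_mat D \<and> (\<forall>i<n. 0 < D $$ (i, i))"

definition DT_diagonally_stable :: "nat \<Rightarrow> real mat \<Rightarrow> bool" where
  "DT_diagonally_stable n A \<longleftrightarrow>
     (\<exists>P. pos_diagonal_mat n P \<and> transpose_mat A * P * A \<prec> P)"

text \<open>Meant for \<open>A \<in> carrier_mat n n\<close> and \<open>1 \<le> k \<le> n - 1\<close>.\<close>

definition DT_k_diagonally_stable :: "nat \<Rightarrow> nat \<Rightarrow> real mat \<Rightarrow> bool" where
  "DT_k_diagonally_stable n k A \<longleftrightarrow>
     (\<exists>D. pos_diagonal_mat (n choose k) D \<and>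
          transpose_mat (compound_mat k A) * D * compound_mat k A \<prec> D)"


lemma sorted_wrt_subseqs:
  "sorted_wrt (<) (zs :: nat list) \<Longrightarrow> xs \<in> set (subseqs zs) \<Longrightarrow>
     sorted_wrt (<) xs \<and> set xs \<subseteq> set zs"
proof (induction zs arbitrary: xs)
  case Nil
  then show ?case by simp
next
  case (Cons z zs)
  from Cons.prems(2) consider "xs \<in> set (subseqs zs)"
    | ys where "xs = z # ys" "ys \<in> set (subseqs zs)"
    by (auto simp: Let_def)
  then show ?case
  proof cases
    case 1
    then show ?thesis using Cons.IH[of xs] Cons.prems(1) by auto
  next
    case 2
    then show ?thesis using Cons.IH[of ys] Cons.prems(1) by auto
  qed
qed

lemma set_ksubsets:
  "set (ksubsets n k) = {xs. sorted_wrt (<) xs \<and> set xs \<subseteq> {..<n} \<and> length xs = k}"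
proof (intro equalityI subsetI)
  fix xs assume "xs \<in> set (ksubsets n k)"
  then show "xs \<in> {xs. sorted_wrt (<) xs \<and> set xs \<subseteq> {..<n} \<and> length xs = k}"
    using sorted_wrt_subseqs[of "[0..<n]" xs] by (auto simp: ksubsets_def)
next
  fix xs assume "xs \<in> {xs. sorted_wrt (<) xs \<and> set xs \<subseteq> {..<n} \<and> length xs = k}"
  then have xs: "sorted_wrt (<) xs" "set xs \<subseteq> set [0..<n]" "length xs = k" by auto
  then have "set xs \<in> set ` set (subseqs [0..<n])"
    unfolding subseqs_powset by blast
  then obtain ys where ys: "set xs = set ys" "ys \<in> set (subseqs [0..<n])"
    by (rule imageE)
  then have "sorted_wrt (<) ys" using sorted_wrt_subseqs[OF _ ys(2)] by simp
  from strict_sorted_equal[OF xs(1) this] have "ys = xs" using ys(1) by blast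
  with ys(2) xs(3) show "xs \<in> set (ksubsets n k)"
    unfolding ksubsets_def by simp
qed

lemma sorted_wrt_lex_ksubsets:
  "sorted_wrt (\<lambda>xs ys. (xs, ys) \<in> lexord {(a, b). a < b}) (ksubsets n k)"
proof -
  have "sorted_wrt (\<lambda>xs ys. (xs, ys) \<in> lexord {(a, b). a < b})
          (filter (\<lambda>xs. length xs = k) (subseqs zs))"
    if "sorted_wrt (<) zs" for zs :: "nat list"
    using that
  proof (induction zs arbitrary: k)
    case Nil
    then show ?case by simp
  next
    case (Cons z zs)
    have s: "sorted_wrt (<) zs" and z: "\<forall>x\<in>set zs. z < x" using Cons.prems by auto
    have 1: "sorted_wrt (\<lambda>xs ys. (xs, ys) \<in> lexord {(a, b). a < b})
        (filter (\<lambda>xs. length xs = k) (map (Cons z) (subseqs zs)))"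
    proof (cases k)
      case 0
      then show ?thesis by (simp add: filter_map o_def)
    next
      case (Suc j)
      then show ?thesis
        using Cons.IH[OF s, of j] by (simp add: filter_map o_def sorted_wrt_map)
    qed
    have 2: "(z # xs, ys) \<in> lexord {(a, b). a < b}"
      if len: "length (z # xs) = k" "length ys = k" and mem: "ys \<in> set (subseqs zs)" for xs ys
    proof -
      obtain y ys' where ys: "ys = y # ys'" using len by (cases ys) auto
      then have "y \<in> set zs" using sorted_wrt_subseqs[OF s mem] by auto
      then show ?thesis using z ys by simp
    qed
    show ?case
      unfolding subseqs.simps Let_def filter_append sorted_wrt_append
    proof (intro conjI ballI)
      fix us vs
      assume "us \<in> set (filter (\<lambda>xs. length xs = k) (map (Cons z) (subseqs zs)))"
        and "vs \<in> set (filter (\<lambda>xs. length xs = k) (subseqs zs))"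
      then obtain xs where "us = z # xs" "length (z # xs) = k" "length vs = k" "vs \<in> set (subseqs zs)"
        by auto
      then show "(us, vs) \<in> lexord {(a, b). a < b}" using 2[of xs vs] by blast
    qed (rule 1 Cons.IH[OF s])+
  qed
  from this[of "[0..<n]"] show ?thesis by (simp add: ksubsets_def)
qed

lemma length_ksubsets: "length (ksubsets n k) = n choose k"
proof -
  have d: "distinct (map set (subseqs [0..<n]))" by (rule distinct_set_subseqs) simp
  then have d': "distinct (map set (ksubsets n k))"
    unfolding ksubsets_def by (rule distinct_map_filter)
  have "set (map set (ksubsets n k)) = {K. K \<subseteq> {..<n} \<and> card K = k}"
  proof (intro equalityI subsetI)
    fix K assume "K \<in> set (map set (ksubsets n k))"
    then show "K \<in> {K. K \<subseteq> {..<n} \<and> card K = k}"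
      by (auto simp: set_ksubsets strict_sorted_iff distinct_card)
  next
    fix K assume K: "K \<in> {K. K \<subseteq> {..<n} \<and> card K = k}"
    then have "finite K" using finite_subset by blast
    with K have "sorted_list_of_set K \<in> set (ksubsets n k)" and "set (sorted_list_of_set K) = K"
      by (auto simp: set_ksubsets)
    then show "K \<in> set (map set (ksubsets n k))"
      by (metis image_eqI list.set_map)
  qed
  then have "length (map set (ksubsets n k)) = card {K. K \<subseteq> {..<n} \<and> card K = k}"
    using distinct_card[OF d'] by simp
  then show ?thesis using n_subsets[of "{..<n}" k] by simp
qed

lemma compound_mat_carrier:
  "A \<in> carrier_mat n n \<Longrightarrow> compound_mat k A \<in> carrier_mat (n choose k) (n choose k)"
  by (simp add: compound_mat_def Let_def length_ksubsets)

end

theory Submission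
  imports Defs "HOL-Combinatorics.Multiset_Permutations"
begin

text \<open>Stability says that \<open>A\<close> is a strict contraction for the norm weighted by \<open>P\<close>. Then so is
  its \<open>k\<close>th tensor power, as one sees by applying \<open>A\<close> to one slot at a time. The \<open>k\<close>th compound
  is the restriction of the tensor power to alternating tensors: a vector \<open>v\<close> indexed by
  \<open>k\<close>-subsets \<open>J\<close> becomes the tensor whose entry at a \<open>k\<close>-tuple \<open>x\<close> is the sum over \<open>J\<close> of
  \<open>v\<close> at \<open>J\<close> times the minor of the identity with rows \<open>x\<close> and columns \<open>J\<close>. On such tensors the
  weighted norm is \<open>k!\<close> times the one given by the diagonal compound of \<open>P\<close>, which therefore
  serves as \<open>D\<close>.\<close>

section \<open>Weighted quadratic forms\<close>

lemma diagonal_mat_quadratic_form: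
  fixes D :: "real mat"
  assumes "D \<in> carrier_mat m m" "diagonal_mat D" "v \<in> carrier_vec m"
  shows "v \<bullet> (D *\<^sub>v v) = (\<Sum>i<m. D $$ (i, i) * (v $ i)\<^sup>2)"
proof -
  have "(D *\<^sub>v v) $ i = D $$ (i, i) * v $ i" if "i < m" for i
  proof -
    have "(D *\<^sub>v v) $ i = (\<Sum>j = 0..<m. D $$ (i, j) * v $ j)"
      using assms that by (simp add: scalar_prod_def)
    also have "\<dots> = (\<Sum>j = 0..<m. if j = i then D $$ (i, i) * v $ i else 0)"
      using assms that by (intro sum.cong) (auto simp: diagonal_mat_def)
    finally show ?thesis using that by simp
  qed
  then show ?thesis
    using assms by (simp add: scalar_prod_def lessThan_atLeast0 power2_eq_square ac_simps)
qed

text \<open>At a vector \<open>v\<close>, the quadratic form of the difference of the two sides is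
  the weighted square norm of \<open>v\<close> minus that of \<open>B *\<^sub>v v\<close>. The
  theorem uses one direction for \<open>A\<close> and \<open>P\<close>, the other for the compound
  and its diagonal weight.\<close>

lemma loewner_less_congruence_iff:
  assumes B: "B \<in> carrier_mat m m" and D: "pos_diagonal_mat m D"
  shows "transpose_mat B * D * B \<prec> D \<longleftrightarrow>
    (\<forall>v \<in> carrier_vec m. v \<noteq> 0\<^sub>v m \<longrightarrow>
       (\<Sum>i<m. D $$ (i, i) * ((B *\<^sub>v v) $ i)\<^sup>2) < (\<Sum>i<m. D $$ (i, i) * (v $ i)\<^sup>2))"
proof -
  define M where "M = transpose_mat B * D * B"
  have Dc: "D \<in> carrier_mat m m" and Dd: "diagonal_mat D"
    using D by (auto simp: pos_diagonal_mat_def)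
  have Mc: "M \<in> carrier_mat m m" unfolding M_def using B Dc by simp
  \<comment> \<open>\<open>loewner_less\<close> demands symmetry of both sides, and
    \<open>pos_def_mat\<close> that of their difference; \<open>Dt\<close>, \<open>Mt\<close> and
    \<open>DMt\<close> supply this.\<close>
  have Dt: "transpose_mat D = D"
  proof (rule eq_matI)
    fix i j assume "i < dim_row D" "j < dim_col D"
    then show "transpose_mat D $$ (i, j) = D $$ (i, j)"
      using Dc Dd by (cases "i = j") (auto simp: diagonal_mat_def)
  qed (use Dc in auto)
  have "transpose_mat M = transpose_mat B * transpose_mat (transpose_mat B * D)"
    unfolding M_def using B Dc by (intro transpose_mult) auto
  also have "\<dots> = transpose_mat B * (transpose_mat D * transpose_mat (transpose_mat B))"
    using B Dc by (subst transpose_mult[of _ m m]) auto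
  also have "\<dots> = M" unfolding M_def using B Dc by (simp add: Dt)
  finally have Mt: "transpose_mat M = M" .
  have DMt: "transpose_mat (D - M) = D - M"
    using Dc Mc by (simp add: transpose_minus Dt Mt)
  have "v \<bullet> ((D - M) *\<^sub>v v) =
      (\<Sum>i<m. D $$ (i, i) * (v $ i)\<^sup>2) - (\<Sum>i<m. D $$ (i, i) * ((B *\<^sub>v v) $ i)\<^sup>2)"
    if v: "v \<in> carrier_vec m" for v
  proof -
    have Bv: "B *\<^sub>v v \<in> carrier_vec m" using B v by simp
    have "M *\<^sub>v v = transpose_mat B *\<^sub>v (D *\<^sub>v (B *\<^sub>v v))"
      unfolding M_def using B Dc v by (simp add: assoc_mult_mat_vec[of _ m m _ m])
    then have "v \<bullet> (M *\<^sub>v v) = (B *\<^sub>v v) \<bullet> (D *\<^sub>v (B *\<^sub>v v))"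
      using transpose_vec_mult_scalar[OF B v, of "D *\<^sub>v (B *\<^sub>v v)"] B Dc Bv v
      by (simp add: comm_scalar_prod[of v m] comm_scalar_prod[of "B *\<^sub>v v" m])
    moreover have "v \<bullet> ((D - M) *\<^sub>v v) = v \<bullet> (D *\<^sub>v v) - v \<bullet> (M *\<^sub>v v)"
      using Dc Mc v by (simp add: minus_mult_distrib_mat_vec[of _ m m] scalar_prod_minus_distrib[of _ m])
    ultimately show ?thesis
      using diagonal_mat_quadratic_form[OF Dc Dd] v Bv by simp
  qed
  then show ?thesis
    unfolding M_def[symmetric] using Dc Mc
    by (auto simp: loewner_less_def pos_def_mat_def symmetric_mat_def Dt Mt DMt
        simp del: index_mult_mat_vec)
qed

section \<open>Tensor powers of a contraction\<close>

definition tuples :: "nat \<Rightarrow> nat \<Rightarrow> nat list set" where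
  "tuples n k = {xs. set xs \<subseteq> {..<n} \<and> length xs = k}"

text \<open>The entry of the Kronecker power of \<open>a\<close> at two multi-indices of equal
  length.\<close>

definition tensor_entry :: "(nat \<Rightarrow> nat \<Rightarrow> 'a) \<Rightarrow> nat list \<Rightarrow> nat list \<Rightarrow> 'a::comm_monoid_mult" where
  "tensor_entry a xs ys = (\<Prod>i<length xs. a (xs ! i) (ys ! i))"

lemma finite_tuples [simp]: "finite (tuples n k)"
  unfolding tuples_def by (rule finite_lists_length_eq) simp

lemma tuples_0 [simp]: "tuples n 0 = {[]}"
  by (auto simp: tuples_def)

lemma tensor_entry_Nil [simp]: "tensor_entry a [] ys = 1"
  by (simp add: tensor_entry_def)

lemma tensor_entry_Cons [simp]:
  "tensor_entry a (x # xs) (y # ys) = a x y * tensor_entry a xs ys"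
  unfolding tensor_entry_def length_Cons prod.lessThan_Suc_shift by simp

lemma tuples_Suc: "tuples n (Suc k) = (\<lambda>(x, xs). x # xs) ` ({..<n} \<times> tuples n k)"
  by (force simp: tuples_def length_Suc_conv image_iff)

lemma sum_tuples_Suc:
  "(\<Sum>xs\<in>tuples n (Suc k). h xs) = (\<Sum>x<n. \<Sum>xs\<in>tuples n k. h (x # xs))"
  unfolding tuples_Suc
  by (subst sum.reindex) (auto simp: inj_on_def sum.cartesian_product case_prod_unfold o_def)

lemma prod_list_map_pos:
  fixes p :: "'b \<Rightarrow> 'a::linordered_semidom"
  shows "(\<And>x. x \<in> set xs \<Longrightarrow> 0 < p x) \<Longrightarrow> 0 < prod_list (map p xs)"
  by (induction xs) auto

text \<open>Induction on \<open>k\<close>: \<open>a\<close> acts on the first slot, then the smaller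
  tensor power on the rest. The weak bound is carried along because the induction hypothesis is
  applied to slices that may vanish; strictness comes from the first slot alone. For
  \<open>k = 0\<close> the tensor power is the identity on scalars, hence
  \<open>0 < k\<close>.\<close>

lemma tensor_contraction:
  fixes p :: "nat \<Rightarrow> real" and a :: "nat \<Rightarrow> nat \<Rightarrow> real" and f :: "nat list \<Rightarrow> real"
  assumes p: "\<And>i. i < n \<Longrightarrow> 0 < p i"
    and a: "\<And>u. \<exists>i<n. u i \<noteq> 0 \<Longrightarrow>
      (\<Sum>i<n. p i * (\<Sum>j<n. a i j * u j)\<^sup>2) < (\<Sum>i<n. p i * (u i)\<^sup>2)"
  defines "w \<equiv> \<lambda>xs. prod_list (map p xs)"
  shows "(\<Sum>xs\<in>tuples n k. w xs * (\<Sum>ys\<in>tuples n k. tensor_entry a xs ys * f ys)\<^sup>2)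
      \<le> (\<Sum>xs\<in>tuples n k. w xs * (f xs)\<^sup>2) \<and>
    (0 < k \<and> (\<exists>xs\<in>tuples n k. f xs \<noteq> 0) \<longrightarrow>
      (\<Sum>xs\<in>tuples n k. w xs * (\<Sum>ys\<in>tuples n k. tensor_entry a xs ys * f ys)\<^sup>2)
      < (\<Sum>xs\<in>tuples n k. w xs * (f xs)\<^sup>2))"
proof (induction k arbitrary: f)
  case 0
  then show ?case by simp
next
  case (Suc k)
  have wpos: "0 < w xs" if "xs \<in> tuples n k" for xs
    using that p unfolding w_def tuples_def by (auto intro!: prod_list_map_pos)
  have a_le: "(\<Sum>i<n. p i * (\<Sum>j<n. a i j * u j)\<^sup>2) \<le> (\<Sum>i<n. p i * (u i)\<^sup>2)" for u
  proof (cases "\<exists>i<n. u i \<noteq> 0")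
    case True
    then show ?thesis using a by (simp add: less_imp_le)
  next
    case False
    then show ?thesis by simp
  qed
  \<comment> \<open>This is \<open>f\<close> with \<open>a\<close> applied to its first slot
    only.\<close>
  define g where "g x xs = (\<Sum>y<n. a x y * f (y # xs))" for x xs
  have "(\<Sum>ys\<in>tuples n (Suc k). tensor_entry a (x # xs) ys * f ys)
      = (\<Sum>zs\<in>tuples n k. tensor_entry a xs zs * g x zs)" for x xs
    unfolding sum_tuples_Suc g_def
    by (subst sum.swap) (simp add: sum_distrib_left ac_simps)
  then have "(\<Sum>xs\<in>tuples n (Suc k). w xs * (\<Sum>ys\<in>tuples n (Suc k). tensor_entry a xs ys * f ys)\<^sup>2)
      = (\<Sum>x<n. p x * (\<Sum>xs\<in>tuples n k. w xs * (\<Sum>zs\<in>tuples n k. tensor_entry a xs zs * g x zs)\<^sup>2))"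
    unfolding sum_tuples_Suc[of _ _ k] by (simp add: w_def sum_distrib_left ac_simps)
  also have "\<dots> \<le> (\<Sum>x<n. p x * (\<Sum>xs\<in>tuples n k. w xs * (g x xs)\<^sup>2))"
    using p by (intro conjunct1[OF Suc.IH] sum_mono mult_left_mono) (auto intro: less_imp_le)
  \<comment> \<open>After the swap the tail \<open>xs\<close> is frozen, and the inner sum is the
    weighted square norm of a vector in the first slot, where the hypothesis on \<open>a\<close>
    applies.\<close>
  also have "\<dots> = (\<Sum>xs\<in>tuples n k. w xs * (\<Sum>x<n. p x * (g x xs)\<^sup>2))"
    by (subst (2) sum_distrib_left, subst sum_distrib_left, subst sum.swap) (simp add: ac_simps)
  finally have 1: "(\<Sum>xs\<in>tuples n (Suc k). w xs * (\<Sum>ys\<in>tuples n (Suc k). tensor_entry a xs ys * f ys)\<^sup>2)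
      \<le> (\<Sum>xs\<in>tuples n k. w xs * (\<Sum>x<n. p x * (g x xs)\<^sup>2))" .
  have 2: "(\<Sum>xs\<in>tuples n (Suc k). w xs * (f xs)\<^sup>2)
      = (\<Sum>xs\<in>tuples n k. w xs * (\<Sum>x<n. p x * (f (x # xs))\<^sup>2))"
    unfolding sum_tuples_Suc
    by (subst sum.swap) (simp add: w_def sum_distrib_left ac_simps)
  have 3: "w xs * (\<Sum>x<n. p x * (g x xs)\<^sup>2) \<le> w xs * (\<Sum>x<n. p x * (f (x # xs))\<^sup>2)"
    if "xs \<in> tuples n k" for xs
    using wpos[OF that] a_le[of "\<lambda>x. f (x # xs)"] unfolding g_def
    by (intro mult_left_mono) (auto simp: less_imp_le)
  \<comment> \<open>One tail \<open>xs\<close> with a nonzero slice \<open>f (x # xs)\<close> gives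
    a strict decrease; every other tail gives a weak one by \<open>3\<close>.\<close>
  have 4: "(\<Sum>xs\<in>tuples n k. w xs * (\<Sum>x<n. p x * (g x xs)\<^sup>2))
      < (\<Sum>xs\<in>tuples n k. w xs * (\<Sum>x<n. p x * (f (x # xs))\<^sup>2))"
    if "\<exists>xs\<in>tuples n (Suc k). f xs \<noteq> 0"
  proof (rule sum_strict_mono_ex1)
    from that obtain x xs where x: "x < n" "xs \<in> tuples n k" "f (x # xs) \<noteq> 0"
      unfolding tuples_Suc by auto
    then have "w xs * (\<Sum>x<n. p x * (g x xs)\<^sup>2) < w xs * (\<Sum>x<n. p x * (f (x # xs))\<^sup>2)"
      using wpos a[of "\<lambda>x. f (x # xs)"] unfolding g_def by (intro mult_strict_left_mono) auto
    with x show "\<exists>xs\<in>tuples n k. w xs * (\<Sum>x<n. p x * (g x xs)\<^sup>2)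
        < w xs * (\<Sum>x<n. p x * (f (x # xs))\<^sup>2)" by blast
  qed (use 3 in auto)
  show ?case
    using 1 4 sum_mono[of "tuples n k", OF 3] unfolding 2 by (meson le_less_trans order_trans)
qed

section \<open>Minors indexed by tuples\<close>

text \<open>Index lists may be unsorted or have repetitions, so that a minor is an alternating
  function of its row tuple.\<close>

definition list_minor :: "(nat \<Rightarrow> nat \<Rightarrow> 'a) \<Rightarrow> nat list \<Rightarrow> nat list \<Rightarrow> 'a::comm_ring_1" where
  "list_minor a xs ys = det (mat (length xs) (length xs) (\<lambda>(i, j). a (xs ! i) (ys ! j)))"

lemma list_minor_leibniz:
  "list_minor a xs ys = (\<Sum>q | q permutes {0..<length xs}.
     signof q * tensor_entry a xs (map (\<lambda>i. ys ! q i) [0..<length xs]))"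
  unfolding list_minor_def
  by (subst det_def'[OF mat_carrier])
    (auto intro!: sum.cong prod.cong simp: tensor_entry_def lessThan_atLeast0 permutes_in_image)

lemma tensor_entry_delta:
  "length zs = length xs \<Longrightarrow>
     tensor_entry (\<lambda>i j. of_bool (i = j)) xs zs = (of_bool (xs = zs) :: 'a::comm_semiring_1)"
  unfolding tensor_entry_def by (induction zs xs rule: list_induct2)
    (auto simp: prod.lessThan_Suc_shift simp del: prod.lessThan_Suc)

text \<open>The link between compound and tensor power: the tensor power of \<open>a\<close> maps
  the tensor of identity minors with columns \<open>ys\<close> to the tensor of minors of
  \<open>a\<close>. By the Leibniz formula the identity minor at \<open>zs\<close> is a signed sum
  of indicators that \<open>zs\<close> is \<open>ys\<close> rearranged by \<open>q\<close>, so the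
  sum over \<open>zs\<close> leaves the Leibniz terms of the minor of \<open>a\<close>.\<close>

lemma list_minor_expand:
  fixes a :: "nat \<Rightarrow> nat \<Rightarrow> 'a::comm_ring_1"
  assumes "xs \<in> tuples n k" "ys \<in> tuples n k"
  shows "list_minor a xs ys =
    (\<Sum>zs\<in>tuples n k. tensor_entry a xs zs * list_minor (\<lambda>i j. of_bool (i = j)) zs ys)"
proof -
  let ?m = "\<lambda>q. map (\<lambda>i. ys ! q i) [0..<k]"
  have len: "length xs = k" and ys: "set ys \<subseteq> {..<n}" "length ys = k"
    using assms by (auto simp: tuples_def)
  have mem: "?m q \<in> tuples n k" if "q permutes {0..<k}" for q
  proof -
    have "ys ! q i \<in> {..<n}" if "i < k" for i
      using ys permutes_in_image[OF \<open>q permutes {0..<k}\<close>, of i] that nth_mem[of "q i" ys]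
      by (auto simp del: nth_mem)
    then show ?thesis by (auto simp: tuples_def)
  qed
  have "(\<Sum>zs\<in>tuples n k. tensor_entry a xs zs * list_minor (\<lambda>i j. of_bool (i = j)) zs ys)
      = (\<Sum>zs\<in>tuples n k. \<Sum>q | q permutes {0..<k}. if zs = ?m q
           then signof q * tensor_entry a xs (?m q) else 0)"
  proof (rule sum.cong[OF refl])
    fix zs assume "zs \<in> tuples n k"
    then have "length zs = k" by (simp add: tuples_def)
    then have "list_minor (\<lambda>i j. of_bool (i = j)) zs ys
        = (\<Sum>q | q permutes {0..<k}. signof q * of_bool (zs = ?m q) :: 'a)"
      by (simp add: list_minor_leibniz tensor_entry_delta)
    then show "tensor_entry a xs zs * list_minor (\<lambda>i j. of_bool (i = j)) zs ys
        = (\<Sum>q | q permutes {0..<k}. if zs = ?m q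
             then signof q * tensor_entry a xs (?m q) else 0)"
      by (simp only: sum_distrib_left) (auto intro: sum.cong)
  qed
  \<comment> \<open>With the sum over \<open>zs\<close> inside, exactly one term survives for each
    \<open>q\<close>, since \<open>?m q\<close> is itself a tuple by \<open>mem\<close>.\<close>
  also have "\<dots> = (\<Sum>q | q permutes {0..<k}. signof q * tensor_entry a xs (?m q))"
    by (subst sum.swap) (auto intro!: sum.cong simp: mem)
  finally show ?thesis by (simp add: list_minor_leibniz len)
qed

lemma list_minor_not_distinct:
  assumes "\<not> distinct xs"
  shows "list_minor a xs ys = 0"
proof -
  from assms obtain i j where "i < length xs" "j < length xs" "i \<noteq> j" "xs ! i = xs ! j"
    by (auto simp: distinct_conv_nth)
  then show ?thesis unfolding list_minor_def
    by (intro det_identical_rows[OF mat_carrier, of i j]) (auto intro!: eq_vecI)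
qed

text \<open>The factor \<open>s\<close> is the sign of a permutation taking \<open>zs\<close> to
  \<open>xs\<close>. It is the same for all \<open>a\<close> and \<open>ys\<close>, so it factors
  out of any linear combination of minors and disappears on squaring.\<close>

lemma list_minor_permute:
  assumes "mset xs = mset zs"
  obtains s :: "'a::comm_ring_1"
  where "s * s = 1" "\<And>a ys. list_minor a xs ys = s * list_minor a zs ys"
proof -
  obtain q where q: "q permutes {..<length zs}" "permute_list q zs = xs"
    using mset_eq_permutation[OF assms] by blast
  have len: "length xs = length zs" using assms by (rule mset_eq_length)
  have nth: "xs ! i = zs ! q i" if "i < length zs" for i
    using permute_list_nth[OF q(1) that] q(2) by simp
  have q0: "q permutes {0..<length zs}"
    using q(1) by (simp only: lessThan_atLeast0)
  have "list_minor a xs ys = signof q * list_minor a zs ys" for a :: "nat \<Rightarrow> nat \<Rightarrow> 'a" and ys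
  proof -
    define Z where "Z = mat (length zs) (length zs) (\<lambda>(i, j). a (zs ! i) (ys ! j))"
    have "mat (length xs) (length xs) (\<lambda>(i, j). a (xs ! i) (ys ! j)) =
        mat (length zs) (length zs) (\<lambda>(i, j). Z $$ (q i, j))"
    proof (rule eq_matI)
      fix i j
      assume "i < dim_row (mat (length zs) (length zs) (\<lambda>(i, j). Z $$ (q i, j)))"
        "j < dim_col (mat (length zs) (length zs) (\<lambda>(i, j). Z $$ (q i, j)))"
      then have ij: "i < length zs" "j < length zs" by simp_all
      then have "q i < length zs" using permutes_in_image[OF q(1), of i] by simp
      then show "mat (length xs) (length xs) (\<lambda>(i, j). a (xs ! i) (ys ! j)) $$ (i, j)
          = mat (length zs) (length zs) (\<lambda>(i, j). Z $$ (q i, j)) $$ (i, j)"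
        using ij by (simp add: len nth Z_def)
    qed (simp_all add: len)
    moreover have "det (mat (length zs) (length zs) (\<lambda>(i, j). Z $$ (q i, j))) = signof q * det Z"
      by (rule det_permute_rows[OF _ q0]) (simp add: Z_def)
    ultimately show ?thesis by (simp only: list_minor_def Z_def)
  qed
  moreover have "signof q * signof q = (1 :: 'a)" by (simp add: sign_def)
  ultimately show thesis using that by blast
qed

text \<open>This recovers a vector from its alternating tensor. Distinct increasing lists have
  distinct sets, so neither is a rearrangement of the other and every Leibniz term vanishes.\<close>

lemma list_minor_delta_ksubsets:
  assumes "xs \<in> set (ksubsets n k)" "ys \<in> set (ksubsets n k)"
  shows "list_minor (\<lambda>i j. of_bool (i = j)) xs ys = (of_bool (xs = ys) :: 'a::comm_ring_1)"
proof (cases "xs = ys")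
  case True
  have "distinct xs" using assms by (auto simp: set_ksubsets strict_sorted_iff)
  then have "mat (length xs) (length xs) (\<lambda>(i, j). of_bool (xs ! i = xs ! j)) = (1\<^sub>m (length xs) :: 'a mat)"
    by (auto intro!: eq_matI simp: nth_eq_iff_index_eq)
  then show ?thesis using True by (simp add: list_minor_def)
next
  case False
  have len: "length xs = k" "length ys = k"
    using assms by (auto simp: set_ksubsets)
  have "set xs \<noteq> set ys"
    using strict_sorted_equal[of xs ys] False assms by (auto simp: set_ksubsets)
  have no: "xs \<noteq> map (\<lambda>i. ys ! q i) [0..<length xs]" if "q permutes {0..<length xs}" for q
  proof
    assume "xs = map (\<lambda>i. ys ! q i) [0..<length xs]"
    then have "set xs = (!) ys ` q ` {0..<length xs}"
      by (metis image_image list.set_map set_upt)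
    also have "\<dots> = set ys"
      unfolding permutes_image[OF that] by (auto simp: len set_conv_nth)
    finally show False using \<open>set xs \<noteq> set ys\<close> by blast
  qed
  then show ?thesis using False
    by (auto simp: list_minor_leibniz tensor_entry_delta intro!: sum.neutral)
qed

section \<open>Sums over k-element subsets\<close>

lemma distinct_ksubsets: "distinct (ksubsets n k)"
  unfolding ksubsets_def
  using distinct_set_subseqs[of "[0..<n]"] by (simp add: distinct_map)

lemma ksubsets_subset_tuples: "set (ksubsets n k) \<subseteq> tuples n k"
  by (auto simp: set_ksubsets tuples_def)

lemma sum_nth_ksubsets:
  "(\<Sum>i<n choose k. h (ksubsets n k ! i)) = (\<Sum>xs\<in>set (ksubsets n k). h xs)"
  by (rule sum.reindex_bij_betw, rule bij_betw_nth) (auto simp: distinct_ksubsets length_ksubsets)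

text \<open>Tuples with repetitions contribute nothing; the others are grouped by their sorted list,
  and each group has \<open>k!\<close> members with the same value.\<close>

lemma sum_tuples_alternating:
  fixes h :: "nat list \<Rightarrow> 'a::{comm_semiring_1,semiring_char_0}"
  assumes "\<And>xs. \<not> distinct xs \<Longrightarrow> h xs = 0"
    and h: "\<And>xs ys. mset xs = mset ys \<Longrightarrow> h xs = h ys"
  shows "(\<Sum>xs\<in>tuples n k. h xs) = fact k * (\<Sum>xs\<in>set (ksubsets n k). h xs)"
proof -
  let ?S = "{xs \<in> tuples n k. distinct xs}"
  have "(\<Sum>xs\<in>tuples n k. h xs) = (\<Sum>xs\<in>?S. h xs)"
    using assms(1) by (intro sum.mono_neutral_right) auto
  also have "\<dots> = (\<Sum>zs\<in>set (ksubsets n k). \<Sum>xs | xs \<in> ?S \<and> sort xs = zs. h xs)"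
  proof (rule sum.group[symmetric])
    show "sort ` ?S \<subseteq> set (ksubsets n k)"
      by (auto simp: set_ksubsets tuples_def strict_sorted_iff)
  qed simp_all
  also have "\<dots> = (\<Sum>zs\<in>set (ksubsets n k). fact k * h zs)"
  proof (rule sum.cong[OF refl])
    fix zs assume "zs \<in> set (ksubsets n k)"
    then have zs: "sorted zs" "distinct zs" "set zs \<subseteq> {..<n}" "length zs = k"
      by (auto simp: set_ksubsets strict_sorted_iff)
    \<comment> \<open>The fibre of \<open>sort\<close> over \<open>zs\<close> consists of all
      orderings of \<open>set zs\<close>, which are counted by \<open>fact k\<close>.\<close>
    have eq: "{xs. xs \<in> ?S \<and> sort xs = zs} = permutations_of_set (set zs)"
    proof (intro equalityI subsetI)
      fix xs assume "xs \<in> permutations_of_set (set zs)"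
      then have xs: "set xs = set zs" "distinct xs" by (auto simp: permutations_of_set_def)
      then have "length xs = k" using zs distinct_card by metis
      moreover have "sort xs = zs"
        using xs zs by (metis sorted_sort_id sorted_list_of_set_sort_remdups distinct_remdups_id)
      ultimately show "xs \<in> {xs. xs \<in> ?S \<and> sort xs = zs}" using xs zs by (auto simp: tuples_def)
    qed (auto simp: permutations_of_set_def)
    have "(\<Sum>xs | xs \<in> ?S \<and> sort xs = zs. h xs) = (\<Sum>xs | xs \<in> ?S \<and> sort xs = zs. h zs)"
      by (rule sum.cong[OF refl], rule h) auto
    also have "\<dots> = fact k * h zs"
      unfolding eq using zs by (simp add: distinct_card)
    finally show "(\<Sum>xs | xs \<in> ?S \<and> sort xs = zs. h xs) = fact k * h zs" .
  qed
  finally show ?thesis by (simp add: sum_distrib_left)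
qed

section \<open>Compound matrices\<close>

text \<open>This translates the \<open>pick\<close> enumeration behind \<open>submatrix\<close> into
  list indexing: exactly \<open>i\<close> elements of \<open>xs\<close> lie below
  \<open>xs ! i\<close>, namely the earlier ones.\<close>

lemma pick_strict_sorted:
  assumes "sorted_wrt (<) xs" "i < length xs"
  shows "pick (set xs) i = xs ! i"
proof -
  have less: "xs ! j < xs ! i \<longleftrightarrow> j < i" if "j < length xs" for j
    using assms that sorted_wrt_nth_less[OF assms(1)] by (metis linorder_neqE_nat order_less_asym)
  have "{b \<in> set xs. b < xs ! i} = (!) xs ` {..<i}"
    using assms(2) less by (auto simp: set_conv_nth)
  moreover have "inj_on ((!) xs) {..<i}"
    using assms by (auto simp: strict_sorted_iff inj_on_def nth_eq_iff_index_eq)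
  ultimately have "card {b \<in> set xs. b < xs ! i} = i" by (simp add: card_image)
  then show ?thesis using pick_card_in_set[of "xs ! i" "set xs"] assms(2) by simp
qed

lemma compound_mat_index:
  assumes A: "A \<in> carrier_mat n n" and i: "i < n choose k" and j: "j < n choose k"
  shows "compound_mat k A $$ (i, j) =
    list_minor (\<lambda>i j. A $$ (i, j)) (ksubsets n k ! i) (ksubsets n k ! j)"
proof -
  let ?R = "ksubsets n k ! i" and ?C = "ksubsets n k ! j"
  have mem: "?R \<in> set (ksubsets n k)" "?C \<in> set (ksubsets n k)"
    using i j by (auto simp: length_ksubsets)
  then have RC: "sorted_wrt (<) ?R" "set ?R \<subseteq> {..<n}" "length ?R = k"
    "sorted_wrt (<) ?C" "set ?C \<subseteq> {..<n}" "length ?C = k"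
    by (auto simp: set_ksubsets)
  \<comment> \<open>These cardinalities are the dimensions that \<open>submatrix\<close> assigns to
    its result.\<close>
  have card: "card {x. x < n \<and> x \<in> set xs} = k" if "xs \<in> set (ksubsets n k)" for xs
  proof -
    have "{x. x < n \<and> x \<in> set xs} = set xs" "distinct xs" "length xs = k"
      using that by (auto simp: set_ksubsets strict_sorted_iff)
    then show ?thesis by (simp add: distinct_card)
  qed
  have "submatrix A (set ?R) (set ?C) = mat k k (\<lambda>(i, j). A $$ (?R ! i, ?C ! j))"
    using A RC card[OF mem(1)] card[OF mem(2)]
    by (intro eq_matI) (auto simp: submatrix_def pick_strict_sorted)
  then show ?thesis
    using A i j RC by (simp add: compound_mat_def Let_def length_ksubsets list_minor_def)
qed

text \<open>The square of a combination of minors vanishes on repeated rows and is blind to the sign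
  of a row permutation, and the weight ignores order; so each subset is counted \<open>k!\<close>
  times.\<close>

lemma sum_tuples_list_minor:
  fixes a :: "nat \<Rightarrow> nat \<Rightarrow> real"
  shows "(\<Sum>xs\<in>tuples n k. prod_list (map p xs) * (\<Sum>j<r. c j * list_minor a xs (L j))\<^sup>2)
    = fact k * (\<Sum>i<n choose k. prod_list (map p (ksubsets n k ! i)) *
        (\<Sum>j<r. c j * list_minor a (ksubsets n k ! i) (L j))\<^sup>2)"
proof -
  let ?h = "\<lambda>xs. prod_list (map p xs) * (\<Sum>j<r. c j * list_minor a xs (L j))\<^sup>2"
  have inv: "?h xs = ?h zs" if perm: "mset xs = mset zs" for xs zs
  proof -
    obtain s :: real where s: "s * s = 1" "\<And>a ys. list_minor a xs ys = s * list_minor a zs ys"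
      using list_minor_permute[OF perm] by blast
    have "(\<Sum>j<r. c j * list_minor a xs (L j)) = s * (\<Sum>j<r. c j * list_minor a zs (L j))"
      by (simp add: s(2) sum_distrib_left ac_simps)
    then have "(\<Sum>j<r. c j * list_minor a xs (L j))\<^sup>2 = (\<Sum>j<r. c j * list_minor a zs (L j))\<^sup>2"
      using s(1) by (simp add: power_mult_distrib power2_eq_square)
    moreover have "prod_list (map p xs) = prod_list (map p zs)"
      using perm by (metis mset_map prod_mset_prod_list)
    ultimately show ?thesis by simp
  qed
  have "(\<Sum>xs\<in>tuples n k. ?h xs) = fact k * (\<Sum>xs\<in>set (ksubsets n k). ?h xs)"
    by (rule sum_tuples_alternating, simp add: list_minor_not_distinct, rule inv)
  then show ?thesis
    by (simp only: sum_nth_ksubsets[where h = ?h])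
qed

theorem theorem2:
  fixes A :: "real mat" and n :: nat
  assumes "A \<in> carrier_mat n n"
    and "DT_diagonally_stable n A"
  shows "\<forall>k \<in> {1..n - 1}. DT_k_diagonally_stable n k A"
proof
  fix k assume "k \<in> {1..n - 1}"
  then have k: "0 < k" by simp
  note A = assms(1)
  obtain P where P: "pos_diagonal_mat n P" and AP: "transpose_mat A * P * A \<prec> P"
    using assms(2) by (auto simp: DT_diagonally_stable_def)
  define p where "p i = P $$ (i, i)" for i
  define a where "a i j = A $$ (i, j)" for i j
  define w where "w xs = prod_list (map p xs)" for xs
  define \<delta> :: "nat \<Rightarrow> nat \<Rightarrow> real" where "\<delta> i j = of_bool (i = j)" for i j
  define r where "r = n choose k"
  define K where "K i = ksubsets n k ! i" for i
  \<comment> \<open>The weight \<open>w (K i)\<close> is the principal minor of the diagonal matrix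
    \<open>P\<close> on the subset \<open>K i\<close>.\<close>
  define D where "D = mat r r (\<lambda>(i, j). if i = j then w (K i) else 0)"
  have p: "0 < p i" if "i < n" for i
    using P that by (simp add: pos_diagonal_mat_def p_def)
  have K: "K i \<in> set (ksubsets n k)" if "i < r" for i
    using that by (simp add: K_def r_def length_ksubsets)
  have Kt: "K i \<in> tuples n k" if "i < r" for i
    using K[OF that] ksubsets_subset_tuples by blast
  have K_eq: "K i = K j \<longleftrightarrow> i = j" if "i < r" "j < r" for i j
    using that by (simp add: K_def r_def length_ksubsets nth_eq_iff_index_eq distinct_ksubsets)
  have a: "(\<Sum>i<n. p i * (\<Sum>j<n. a i j * u j)\<^sup>2) < (\<Sum>i<n. p i * (u i)\<^sup>2)"
    if u: "\<exists>i<n. u i \<noteq> 0" for u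
  proof -
    have "vec n u \<noteq> 0\<^sub>v n" using u by (metis index_vec index_zero_vec(1))
    moreover have "(A *\<^sub>v vec n u) $ i = (\<Sum>j<n. a i j * u j)" if "i < n" for i
      using A that by (simp add: scalar_prod_def a_def lessThan_atLeast0)
    ultimately show ?thesis
      using loewner_less_congruence_iff[OF A P] AP
      by (auto simp: p_def dest!: bspec[of _ _ "vec n u"])
  qed
  have wpos: "0 < w xs" if "xs \<in> tuples n k" for xs
    using that p unfolding w_def tuples_def by (auto intro!: prod_list_map_pos)
  have D: "pos_diagonal_mat r D"
    using wpos Kt by (auto simp: pos_diagonal_mat_def D_def diagonal_mat_def)
  have C: "compound_mat k A \<in> carrier_mat r r"
    unfolding r_def by (rule compound_mat_carrier[OF A])
  have "(\<Sum>i<r. D $$ (i, i) * ((compound_mat k A *\<^sub>v v) $ i)\<^sup>2) < (\<Sum>i<r. D $$ (i, i) * (v $ i)\<^sup>2)"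
    if v: "v \<in> carrier_vec r" "v \<noteq> 0\<^sub>v r" for v
  proof -
    \<comment> \<open>\<open>f \<delta>\<close> is the alternating tensor of \<open>v\<close>;
      \<open>f a\<close> will be its image under the tensor power, whose entries at the
      \<open>K i\<close> are those of the compound applied to \<open>v\<close>.\<close>
    define f where "f b xs = (\<Sum>j<r. v $ j * list_minor b xs (K j))" for b :: "nat \<Rightarrow> nat \<Rightarrow> real" and xs
    have f\<delta>: "f \<delta> (K i) = v $ i" if "i < r" for i
    proof -
      have "f \<delta> (K i) = (\<Sum>j<r. if j = i then v $ i else 0)"
        unfolding f_def \<delta>_def using that
        by (intro sum.cong) (auto simp: list_minor_delta_ksubsets[OF K K] K_eq)
      then show ?thesis using that by simp
    qed
    have fa: "f a (K i) = (compound_mat k A *\<^sub>v v) $ i" if "i < r" for i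
      using that C v compound_mat_index[OF A, of i k]
      by (simp add: f_def a_def[abs_def] K_def scalar_prod_def lessThan_atLeast0 r_def[symmetric] ac_simps)
    have tensor: "f a xs = (\<Sum>ys\<in>tuples n k. tensor_entry a xs ys * f \<delta> ys)" if "xs \<in> tuples n k" for xs
    proof -
      have "f a xs = (\<Sum>j<r. \<Sum>ys\<in>tuples n k. v $ j * (tensor_entry a xs ys * list_minor \<delta> ys (K j)))"
        unfolding f_def \<delta>_def using list_minor_expand[OF that Kt, of _ a]
        by (intro sum.cong) (auto simp: sum_distrib_left)
      then show ?thesis
        unfolding f_def by (subst (asm) sum.swap) (simp add: sum_distrib_left ac_simps)
    qed
    have sums: "(\<Sum>xs\<in>tuples n k. w xs * (f b xs)\<^sup>2) = fact k * (\<Sum>i<r. D $$ (i, i) * (f b (K i))\<^sup>2)" for b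
      unfolding f_def w_def sum_tuples_list_minor by (simp add: D_def w_def K_def r_def)
    \<comment> \<open>The tensor of a nonzero \<open>v\<close> is nonzero, because
      \<open>f\<delta>\<close> finds the coordinates of \<open>v\<close> among its entries.\<close>
    obtain i where "i < r" "v $ i \<noteq> 0" using v by (auto simp: vec_eq_iff)
    then have "\<exists>xs\<in>tuples n k. f \<delta> xs \<noteq> 0" using f\<delta> Kt by metis
    then have "(\<Sum>xs\<in>tuples n k. w xs * (f a xs)\<^sup>2) < (\<Sum>xs\<in>tuples n k. w xs * (f \<delta> xs)\<^sup>2)"
      using tensor_contraction[where k = k and f = "f \<delta>", OF p a] k by (simp add: tensor w_def)
    \<comment> \<open>Both sides carry the same positive factor \<open>fact k\<close>, which
      cancels.\<close>
    then show ?thesis unfolding sums by (simp add: f\<delta> fa)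
  qed
  then have "transpose_mat (compound_mat k A) * D * compound_mat k A \<prec> D"
    using loewner_less_congruence_iff[OF C D] by blast
  then show "DT_k_diagonally_stable n k A"
    unfolding DT_k_diagonally_stable_def using D r_def by blast
qed

end
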